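(* Let $n\ge1$ and let $f_6:\mathbb{C}_2^{\,n}\times\mathbb{C}_2^{\,n}\to\mathbb{C}_1$ be defined, for $P=(\xi_1,\dots,\xi_n)$ and $Q=(\eta_1,\dots,\eta_n)$, by $$f_6(P,Q)=\sum_{k=1}^n\left((\xi_k)^-\,\overline{(\eta_k)^-}+(\xi_k)^+\,\overline{(\eta_k)^+}\right),$$ where $(\cdot)^-$ and $(\cdot)^+$ denote the idempotent components of a bicomplex number. Then: (a) $f_6(P,P)\ge0$ for all $P\in\mathbb{C}_2^{\,n}$; (b) $f_6(P,P)=0$ if and only if $P=0$; (c) $\overline{f_6(Q,P)}=f_6(P,Q)$ for all $P,Q\in\mathbb{C}_2^{\,n}$; (d) $f_6(P+Q,R)=f_6(P,R)+f_6(Q,R)$ for all $P,Q,R\in\mathbb{C}_2^{\,n}$; (e) $f_6(\alpha P,Q)=\alpha f_6(P,Q)$ for all $P,Q\in\mathbb{C}_2^{\,n}$ and all $\alpha\in\mathbb{C}_1$.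
   Context: $\mathbb{C}_0$ is the set of real numbers and $\mathbb{C}_1=\{a+i_1b: a,b\in\mathbb{C}_0\}$ the set of complex numbers, with complex conjugation written $\overline{\,\cdot\,}$. $\mathbb{C}_2$ is the set of bicomplex numbers $\xi=x_1+i_1x_2+i_2x_3+i_1i_2x_4$ with $x_1,\dots,x_4$ real, where $i_1^2=i_2^2=-1$ and $i_1i_2=i_2i_1$; it is a commutative algebra over $\mathbb{C}_1$ and over $\mathbb{C}_0$. Equivalently $\xi=z_1+i_2z_2$ with $z_1=x_1+i_1x_2$, $z_2=x_3+i_1x_4\in\mathbb{C}_1$, and for $\alpha\in\mathbb{C}_1$, $\alpha\xi=\alpha z_1+i_2\,\alpha z_2$. The idempotent components of $\xi$ are $\xi^-=z_1-i_1z_2$ and $\xi^+=z_1+i_1z_2$ in $\mathbb{C}_1$; with $e_1=(1+i_1i_2)/2$, $e_2=(1-i_1i_2)/2$ one has uniquely $\xi=\xi^-e_1+\xi^+e_2$. $\mathbb{C}_2^{\,n}$ is the set of $n$-tuples of bicomplex numbers, with componentwise addition and $\alpha P=(\alpha\xi_1,\dots,\alpha\xi_n)$ for $\alpha\in\mathbb{C}_1$. For a complex-valued expression, "$\ge 0$" means that it is a nonnegative real number. *)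

theory Defs
  imports "HOL-Analysis.Analysis"
begin

text \<open>
  The bicomplex number \<open>z\<^sub>1 + i\<^sub>2 z\<^sub>2\<close> is represented as the pair of its complex
  components; the imaginary unit \<open>i\<^sub>1\<close> is the unit \<open>\<i>\<close> of the library type
  \<^typ>\<open>complex\<close>.
\<close>

datatype bicomplex = Bicomplex (bc_fst: complex) (bc_snd: complex)

lemma bicomplex_eq_iff:
  "\<xi> = \<eta> \<longleftrightarrow> bc_fst \<xi> = bc_fst \<eta> \<and> bc_snd \<xi> = bc_snd \<eta>"
  by (cases \<xi>; cases \<eta>) simp

instantiation bicomplex :: comm_ring_1
begin

definition zero_bicomplex :: bicomplex
  where "0 = Bicomplex 0 0"

definition one_bicomplex :: bicomplex
  where "1 = Bicomplex 1 0"

definition plus_bicomplex :: "bicomplex \<Rightarrow> bicomplex \<Rightarrow> bicomplex"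
  where "\<xi> + \<eta> = Bicomplex (bc_fst \<xi> + bc_fst \<eta>) (bc_snd \<xi> + bc_snd \<eta>)"

definition uminus_bicomplex :: "bicomplex \<Rightarrow> bicomplex"
  where "- \<xi> = Bicomplex (- bc_fst \<xi>) (- bc_snd \<xi>)"

definition minus_bicomplex :: "bicomplex \<Rightarrow> bicomplex \<Rightarrow> bicomplex"
  where "\<xi> - \<eta> = Bicomplex (bc_fst \<xi> - bc_fst \<eta>) (bc_snd \<xi> - bc_snd \<eta>)"

text \<open>The product is determined by commutativity and \<open>i\<^sub>2\<^sup>2 = -1\<close>.\<close>

definition times_bicomplex :: "bicomplex \<Rightarrow> bicomplex \<Rightarrow> bicomplex"
  where "\<xi> * \<eta> = Bicomplex (bc_fst \<xi> * bc_fst \<eta> - bc_snd \<xi> * bc_snd \<eta>)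
                           (bc_fst \<xi> * bc_snd \<eta> + bc_snd \<xi> * bc_fst \<eta>)"

instance
  by standard
    (simp_all add: bicomplex_eq_iff zero_bicomplex_def one_bicomplex_def plus_bicomplex_def
      uminus_bicomplex_def minus_bicomplex_def times_bicomplex_def algebra_simps)

end

definition cscale :: "complex \<Rightarrow> bicomplex \<Rightarrow> bicomplex"  (infixr "*\<^sub>C" 75)
  where "\<alpha> *\<^sub>C \<xi> = Bicomplex (\<alpha> * bc_fst \<xi>) (\<alpha> * bc_snd \<xi>)"

definition bc_i2 :: bicomplex
  where "bc_i2 = Bicomplex 0 1"

definition bc_e1 :: bicomplex
  where "bc_e1 = (1/2) *\<^sub>C (1 + \<i> *\<^sub>C bc_i2)"

definition bc_e2 :: bicomplex
  where "bc_e2 = (1/2) *\<^sub>C (1 - \<i> *\<^sub>C bc_i2)"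

definition idem_minus :: "bicomplex \<Rightarrow> complex"
  where "idem_minus \<xi> = bc_fst \<xi> - \<i> * bc_snd \<xi>"

definition idem_plus :: "bicomplex \<Rightarrow> complex"
  where "idem_plus \<xi> = bc_fst \<xi> + \<i> * bc_snd \<xi>"

lemmas bicomplex_defs =
  zero_bicomplex_def one_bicomplex_def plus_bicomplex_def uminus_bicomplex_def
  minus_bicomplex_def times_bicomplex_def cscale_def bc_i2_def bc_e1_def bc_e2_def
  idem_minus_def idem_plus_def

lemma bc_i2_squared: "bc_i2 * bc_i2 = - 1"
  by (simp add: bicomplex_defs)

lemma bicomplex_decomp: "\<xi> = bc_fst \<xi> *\<^sub>C 1 + bc_snd \<xi> *\<^sub>C bc_i2"
  by (simp add: bicomplex_defs)

lemma cscale_eq_times: "\<alpha> *\<^sub>C \<xi> = (\<alpha> *\<^sub>C 1) * \<xi>"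
  by (simp add: bicomplex_defs)

lemma idempotent_decomp: "\<xi> = idem_minus \<xi> *\<^sub>C bc_e1 + idem_plus \<xi> *\<^sub>C bc_e2"
  by (simp add: bicomplex_eq_iff bicomplex_defs field_simps)

lemma idempotent_decomp_unique:
  assumes "\<xi> = a *\<^sub>C bc_e1 + b *\<^sub>C bc_e2"
  shows "a = idem_minus \<xi> \<and> b = idem_plus \<xi>"
  unfolding assms by (simp add: bicomplex_defs field_simps)

text \<open>
  An \<open>n\<close>-tuple of bicomplex numbers is an element of \<^typ>\<open>bicomplex ^ 'n\<close> with
  \<open>n = CARD('n) \<ge> 1\<close>; zero and addition are the componentwise library operations.
  The library's \<open>*s\<close> requires scalars of the component type, so scaling by
  complex numbers is introduced separately.
\<close>

definition cscale_vec :: "complex \<Rightarrow> bicomplex ^ 'n \<Rightarrow> bicomplex ^ 'n"  (infixr "*\<^sub>V" 75)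
  where "\<alpha> *\<^sub>V P = (\<chi> k. \<alpha> *\<^sub>C (P $ k))"

definition f6 :: "bicomplex ^ 'n \<Rightarrow> bicomplex ^ 'n \<Rightarrow> complex"
  where "f6 P Q = (\<Sum>k\<in>UNIV. idem_minus (P $ k) * cnj (idem_minus (Q $ k))
                            + idem_plus (P $ k) * cnj (idem_plus (Q $ k)))"

end

theory Submission
  imports Defs
begin

text \<open>
  The idempotent components \<open>\<xi> \<mapsto> \<xi>\<^sup>-\<close> and \<open>\<xi> \<mapsto> \<xi>\<^sup>+\<close> are complex linear, and together they
  determine \<open>\<xi>\<close>, because \<open>\<xi> = \<xi>\<^sup>- e\<^sub>1 + \<xi>\<^sup>+ e\<^sub>2\<close>. They therefore identify \<open>n\<close>-tuples of bicomplex
  numbers with complex vectors of length \<open>2n\<close>, and \<open>f6\<close> is the standard Hermitian inner product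
  carried over by this identification. Additivity and homogeneity come from the linearity of the
  components, and conjugate symmetry from commutativity of the product in \<open>\<complex>\<close>. On the diagonal
  \<open>f6\<close> is a sum of squared moduli, hence nonnegative; it vanishes only if all idempotent
  components vanish, and then the tuple is zero.
\<close>

lemma idem_add:
  "idem_minus (\<xi> + \<eta>) = idem_minus \<xi> + idem_minus \<eta>"
  "idem_plus (\<xi> + \<eta>) = idem_plus \<xi> + idem_plus \<eta>"
  by (simp_all add: bicomplex_defs algebra_simps)

lemma idem_cscale:
  "idem_minus (\<alpha> *\<^sub>C \<xi>) = \<alpha> * idem_minus \<xi>"
  "idem_plus (\<alpha> *\<^sub>C \<xi>) = \<alpha> * idem_plus \<xi>"
  by (simp_all add: bicomplex_defs algebra_simps)

text \<open>
  The decomposition along \<open>e\<^sub>1\<close> and \<open>e\<^sub>2\<close> recovers \<open>\<xi>\<close> from its components, so the linear map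
  \<open>\<xi> \<mapsto> (\<xi>\<^sup>-, \<xi>\<^sup>+)\<close> has trivial kernel. This is what makes \<open>f6\<close> definite.
\<close>

lemma idem_eq_0_iff: "idem_minus \<xi> = 0 \<and> idem_plus \<xi> = 0 \<longleftrightarrow> \<xi> = 0"
proof
  assume "idem_minus \<xi> = 0 \<and> idem_plus \<xi> = 0"
  then show "\<xi> = 0"
    by (subst idempotent_decomp) (simp add: cscale_def zero_bicomplex_def plus_bicomplex_def)
qed (simp add: bicomplex_defs)

lemma f6_self:
  "f6 P P = of_real (\<Sum>k\<in>UNIV. (cmod (idem_minus (P $ k)))\<^sup>2 + (cmod (idem_plus (P $ k)))\<^sup>2)"
  by (simp only: f6_def of_real_sum of_real_add complex_norm_square)

lemma f6_self_nonneg: "f6 P P \<in> \<real>\<^sub>\<ge>\<^sub>0"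
  unfolding f6_self nonneg_Reals_of_real_iff by (simp add: sum_nonneg)

lemma f6_self_eq_0_iff: "f6 P P = 0 \<longleftrightarrow> P = 0"
proof -
  have "f6 P P = 0 \<longleftrightarrow> (\<forall>k. idem_minus (P $ k) = 0 \<and> idem_plus (P $ k) = 0)"
    unfolding f6_self of_real_eq_0_iff
    by (simp add: sum_nonneg_eq_0_iff sum_power2_eq_zero_iff)
  also have "\<dots> \<longleftrightarrow> P = 0"
    by (simp only: idem_eq_0_iff vec_eq_iff zero_index)
  finally show ?thesis .
qed

lemma cnj_f6: "cnj (f6 Q P) = f6 P Q"
  by (simp add: f6_def mult.commute)

lemma f6_add_left: "f6 (P + Q) R = f6 P R + f6 Q R"
  by (simp add: f6_def idem_add sum.distrib[symmetric] algebra_simps)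

lemma f6_cscale_left: "f6 (\<alpha> *\<^sub>V P) Q = \<alpha> * f6 P Q"
  by (simp add: f6_def cscale_vec_def idem_cscale sum_distrib_left algebra_simps)

theorem theorem2p21:
  shows "(\<forall>P :: bicomplex ^ 'n. f6 P P \<in> \<real>\<^sub>\<ge>\<^sub>0) \<and>
    (\<forall>P :: bicomplex ^ 'n. f6 P P = 0 \<longleftrightarrow> P = 0) \<and>
    (\<forall>P Q :: bicomplex ^ 'n. cnj (f6 Q P) = f6 P Q) \<and>
    (\<forall>P Q R :: bicomplex ^ 'n. f6 (P + Q) R = f6 P R + f6 Q R) \<and>
    (\<forall>(P :: bicomplex ^ 'n) Q \<alpha>. f6 (\<alpha> *\<^sub>V P) Q = \<alpha> * f6 P Q)"
  by (simp add: f6_self_nonneg f6_self_eq_0_iff cnj_f6 f6_add_left f6_cscale_left)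

end
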